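(* Suppose that the objective $L(\theta)$ is bounded from below by $L_{\inf}$ in some open subset of its domain, that $g$ is $C^1$ with respect to all variables, that the gradients of $g$ with respect to $\theta$ and $y$ are $L_\theta$- and $L_y$-Lipschitz, respectively (that is, $\frac{\partial g}{\partial\theta}$ is $L_\theta$-Lipschitz in $\theta$ and $\nabla_y g_\theta$ is $L_y$-Lipschitz in $y$), and that the second-order partial derivatives of $g$ with respect to $\theta$ exist. Suppose the approximate fixed point $\tilde y=\tilde y_\theta(z)$ satisfies $\|(\tilde y-z)+\nabla_y g_\theta(\tilde y)\|<\epsilon_p$, and that $\int\|x\|^2\,d\mu(x)<\infty$ and $\int\|z\|^2\,d\nu(z)<\infty$. Suppose further that the norm of the difference between the exact and the computed fixed point satisfies, for all $\theta$ and all $z$, $$\|\tilde y_\theta(z)-y_\theta^*(z)\|<\epsilon\le\frac{V\,\|\nabla_\theta L\|^2}{L_\theta\big(\sqrt{M_x}+\sqrt{M_z}\big)}$$ for some $0<V<1$. Then there exists $U=1-V>0$ such that for all $\theta$ $$\langle\nabla_\theta L,\tilde d_\theta\rangle\ge U\,\|\nabla_\theta L\|^2 .$$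
   Context: $\mu,\nu$ are probability measures on $\mathbb{R}^d$. $g_\theta:\mathbb{R}^d\to\mathbb{R}$, $y\mapsto g_\theta(y)$, is a potential with parameter $\theta\in\mathbb{R}^p$, convex in $y$; $g$ denotes this function of $(\theta,y)$, and $\frac{\partial g_\theta}{\partial\theta}(y)$ is its partial gradient in $\theta$. For $z\in\mathbb{R}^d$, $y_\theta^*(z)$ is the unique minimizer of $y\mapsto\frac12\|y-z\|^2+g_\theta(y)$ (the exact fixed point), and $\tilde y_\theta(z)$ is a computed approximation of it (the approximate fixed point), with residual tolerance $\epsilon_p>0$. The objective is $$L(\theta)=\mathbb{E}_{x\sim\mu}[g_\theta(x)]-\mathbb{E}_{z\sim\nu}\Big[\tfrac12\|y_\theta^*(z)-z\|^2+g_\theta(y_\theta^*(z))\Big],$$ with gradient $\nabla_\theta L=\mathbb{E}_{x\sim\mu}\big[\frac{\partial g_\theta}{\partial\theta}(x)\big]-\mathbb{E}_{z\sim\nu}\big[\frac{\partial g_\theta}{\partial\theta}(y_\theta^*(z))\big]$. The approximate (stochastic) gradient is $\tilde d_\theta=\mathbb{E}_{x\sim\mu}\big[\frac{\partial g_\theta}{\partial\theta}(x)\big]-\mathbb{E}_{z\sim\nu}\big[\frac{\partial g_\theta}{\partial\theta}(\tilde y_\theta(z))\big]$. $M_x$ and $M_z$ denote constants with $0<M_x<+\infty$, $0<M_z<+\infty$ such that $\mathbb{E}_{x\sim\mu}\big[\|\frac{\partial g_\theta}{\partial\theta}(x)\|^2\big]<M_x$ and $\mathbb{E}_{z\sim\nu}\big[\|\frac{\partial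 g_\theta}{\partial\theta}(\tilde y_\theta(z))\|^2\big]<M_z$; their existence is not an additional hypothesis but is asserted as a consequence of the Lipschitz, residual and second-moment hypotheses in the claim.
   Formalization: The claim is false as stated; here the θ-gradient of g is L_θ-Lipschitz also in y, M_z must bound the second moment at every approximate fixed point of residual below ε_p (not only ỹ), M_x, M_z exist for each θ (not uniformly), and ỹ is measurable in z. *)

theory Defs
  imports "HOL-Probability.Probability"
begin

definition grad :: "('a::real_inner \<Rightarrow> real) \<Rightarrow> 'a \<Rightarrow> 'a"
  where "grad f x = (THE D. GDERIV f x :> D)"

lemma grad_eqI: "GDERIV f x :> D \<Longrightarrow> grad f x = D"
proof -
  assume D: "GDERIV f x :> D"
  have "E = D" if "GDERIV f x :> E" for E
  proof -
    have "(\<lambda>h. h \<bullet> E) = (\<lambda>h. h \<bullet> D)"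
      using that D unfolding gderiv_def by (rule has_derivative_unique)
    then have "(E - D) \<bullet> E = (E - D) \<bullet> D" by (rule fun_cong)
    then have "(E - D) \<bullet> (E - D) = 0" by (simp only: inner_diff_right)
    then show ?thesis by simp
  qed
  with D show ?thesis unfolding grad_def by (intro the_equality)
qed

definition continuously_differentiable :: "('a::real_inner \<Rightarrow> real) \<Rightarrow> bool"
  where "continuously_differentiable f \<longleftrightarrow>
    (\<forall>x. GDERIV f x :> grad f x) \<and> continuous_on UNIV (grad f)"

text \<open>A potential is a curried function \<open>g\<close> of the parameter \<open>\<theta>\<close> (first) and the
  point \<open>y\<close> (second).\<close>

definition grad_param ::
    "(real^'p \<Rightarrow> real^'d \<Rightarrow> real) \<Rightarrow> real^'p \<Rightarrow> real^'d \<Rightarrow> real^'p"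
  where "grad_param g \<theta> y = grad (\<lambda>t. g t y) \<theta>"

definition grad_space ::
    "(real^'p \<Rightarrow> real^'d \<Rightarrow> real) \<Rightarrow> real^'p \<Rightarrow> real^'d \<Rightarrow> real^'d"
  where "grad_space g \<theta> y = grad (g \<theta>) y"

text \<open>Existence of all \<open>\<partial>\<^sup>2g / \<partial>\<theta>\<^sub>j \<partial>\<theta>\<^sub>i\<close>, each as a
  one-dimensional derivative along the \<open>j\<close>-th coordinate axis.\<close>

definition second_partials_param_exist :: "(real^'p \<Rightarrow> real^'d \<Rightarrow> real) \<Rightarrow> bool"
  where "second_partials_param_exist g \<longleftrightarrow>
    (\<forall>\<theta> y i j. (\<lambda>s::real. grad_param g (\<theta> + s *\<^sub>R axis j 1) y $ i) differentiable (at 0))"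

definition fixed_point :: "(real^'p \<Rightarrow> real^'d \<Rightarrow> real) \<Rightarrow> real^'p \<Rightarrow> real^'d \<Rightarrow> real^'d"
  where "fixed_point g \<theta> z =
    (THE y. is_arg_min (\<lambda>y. 1/2 * (norm (y - z))\<^sup>2 + g \<theta> y) (\<lambda>_. True) y)"

definition objective ::
    "(real^'d) measure \<Rightarrow> (real^'d) measure \<Rightarrow> (real^'p \<Rightarrow> real^'d \<Rightarrow> real) \<Rightarrow> real^'p \<Rightarrow> real"
  where "objective \<mu> \<nu> g \<theta> =
    (\<integral>x. g \<theta> x \<partial>\<mu>) -
    (\<integral>z. 1/2 * (norm (fixed_point g \<theta> z - z))\<^sup>2 + g \<theta> (fixed_point g \<theta> z) \<partial>\<nu>)"

definition approx_grad ::
    "(real^'d) measure \<Rightarrow> (real^'d) measure \<Rightarrow> (real^'p \<Rightarrow> real^'d \<Rightarrow> real)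
      \<Rightarrow> (real^'p \<Rightarrow> real^'d \<Rightarrow> real^'d) \<Rightarrow> real^'p \<Rightarrow> real^'p"
  where "approx_grad \<mu> \<nu> g ytilde \<theta> =
    (\<integral>x. grad_param g \<theta> x \<partial>\<mu>) - (\<integral>z. grad_param g \<theta> (ytilde \<theta> z) \<partial>\<nu>)"

text \<open>\<open>w\<close> maps each \<open>z\<close> to an approximate fixed point with residual below \<open>\<epsilon>p\<close>.
  Measurability is what makes the expectations over \<open>z\<close> meaningful.\<close>

definition approx_fixed_point ::
    "(real^'d) measure \<Rightarrow> (real^'p \<Rightarrow> real^'d \<Rightarrow> real) \<Rightarrow> real \<Rightarrow> real^'p
      \<Rightarrow> (real^'d \<Rightarrow> real^'d) \<Rightarrow> bool"
  where "approx_fixed_point \<nu> g \<epsilon>p \<theta> w \<longleftrightarrow>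
    w \<in> borel_measurable \<nu> \<and> (\<forall>z. norm ((w z - z) + grad_space g \<theta> (w z)) < \<epsilon>p)"

definition second_moment_less ::
    "(real^'d) measure \<Rightarrow> (real^'d \<Rightarrow> real^'p) \<Rightarrow> real \<Rightarrow> bool"
  where "second_moment_less \<mu> f M \<longleftrightarrow>
    integrable \<mu> (\<lambda>x. (norm (f x))\<^sup>2) \<and> (\<integral>x. (norm (f x))\<^sup>2 \<partial>\<mu>) < M"

text \<open>The constants \<open>M\<^sub>x\<close>, \<open>M\<^sub>z\<close> at parameter \<open>\<theta>\<close>. The bound by
  \<open>M\<^sub>z\<close> is required of every approximate fixed point of residual tolerance \<open>\<epsilon>p\<close>, not
  only of the one that happens to have been computed: a constant adapted to a single
  approximation need not bound the second moment at the exact fixed point.\<close>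

definition moment_constants ::
    "(real^'d) measure \<Rightarrow> (real^'d) measure \<Rightarrow> (real^'p \<Rightarrow> real^'d \<Rightarrow> real) \<Rightarrow> real
      \<Rightarrow> real^'p \<Rightarrow> real \<Rightarrow> real \<Rightarrow> bool"
  where "moment_constants \<mu> \<nu> g \<epsilon>p \<theta> Mx Mz \<longleftrightarrow>
    0 < Mx \<and> 0 < Mz \<and>
    second_moment_less \<mu> (grad_param g \<theta>) Mx \<and>
    (\<forall>w. approx_fixed_point \<nu> g \<epsilon>p \<theta> w \<longrightarrow>
       second_moment_less \<nu> (\<lambda>z. grad_param g \<theta> (w z)) Mz)"

end

theory Submission
  imports Defs
begin

text \<open>
  The proximal objective \<open>1/2 |y - z|\<^sup>2 + g \<theta> y\<close> is strongly convex in \<open>y\<close>. Since \<open>\<partial>g/\<partial>\<theta>\<close> is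
  Lipschitz in \<open>y\<close>, the difference \<open>g (\<theta> + h) - g \<theta>\<close> is \<open>L |h|\<close>-Lipschitz, so the exact fixed point
  is \<open>L\<close>-Lipschitz in \<open>\<theta>\<close>. The envelope formula therefore holds with a remainder \<open>O(|h|\<^sup>2)\<close> uniform
  in \<open>z\<close>, and the gradient \<open>D\<close> of the objective is the difference of the expected partial gradients
  without any appeal to dominated convergence. The approximate gradient is then within \<open>L \<epsilon>\<close> of \<open>D\<close>,
  while \<open>|D| \<le> sqrt Mx + sqrt Mz\<close>, because the exact fixed point has residual 0 and is itself an
  admissible approximate one.
\<close>

section \<open>Mean value and tangent estimates for gradients\<close>

lemma GDERIV_along_line:
  assumes "GDERIV f (x + t *\<^sub>R v) :> D"
  shows "((\<lambda>s. f (x + s *\<^sub>R v)) has_real_derivative (v \<bullet> D)) (at t)"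
proof -
  have "((\<lambda>s. x + s *\<^sub>R v) has_derivative (\<lambda>s. s *\<^sub>R v)) (at t)"
    by (auto intro!: derivative_eq_intros)
  moreover have "(f has_derivative (\<lambda>h. h \<bullet> D)) (at (x + t *\<^sub>R v))"
    using assms by (simp add: gderiv_def)
  ultimately have "((\<lambda>s. f (x + s *\<^sub>R v)) has_derivative (\<lambda>s. (s *\<^sub>R v) \<bullet> D)) (at t)"
    using has_derivative_compose by blast
  then show ?thesis
    unfolding has_field_derivative_def
    by (rule back_subst[where P="\<lambda>F. (_ has_derivative F) _"]) (auto simp: mult.commute)
qed

lemma GDERIV_mvt:
  assumes "\<And>x. GDERIV f x :> D x"
  obtains w where "norm (w - x) \<le> norm (y - x)" "f y - f x = (y - x) \<bullet> D w"
proof -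
  \<comment> \<open>The explicit scalars 1 and 0 exhibit an instance of \<open>MVT2\<close> on [0,1]
    for the restriction of \<open>f\<close> to the segment from \<open>x\<close> to
    \<open>y\<close>.\<close>
  have "\<exists>t>0. t < 1 \<and> f (x + 1 *\<^sub>R (y - x)) - f (x + 0 *\<^sub>R (y - x))
      = (1 - 0) * ((y - x) \<bullet> D (x + t *\<^sub>R (y - x)))"
    by (rule MVT2) (auto intro: GDERIV_along_line assms)
  then obtain t :: real where t: "0 < t" "t < 1"
      and eq: "f y - f x = (y - x) \<bullet> D (x + t *\<^sub>R (y - x))"
    by auto
  have "norm (t *\<^sub>R (y - x)) \<le> 1 * norm (y - x)"
    unfolding norm_scaleR using t by (intro mult_right_mono) auto
  with eq show thesis
    by (intro that[of "x + t *\<^sub>R (y - x)"]) auto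
qed

text \<open>The mean value point is no farther from \<open>x\<close> than \<open>y\<close> is, so
  the gradient there differs from \<open>D x\<close> by at most \<open>L * norm (y - x)\<close>. The
  sharper factor \<open>L / 2\<close> is not pursued; only the quadratic order matters.\<close>

lemma lipschitz_gradient_remainder:
  assumes D: "\<And>x. GDERIV f x :> D x" and L: "L-lipschitz_on UNIV D"
  shows "\<bar>f y - f x - (y - x) \<bullet> D x\<bar> \<le> L * (norm (y - x))\<^sup>2"
proof -
  obtain w where w: "norm (w - x) \<le> norm (y - x)" "f y - f x = (y - x) \<bullet> D w"
    using GDERIV_mvt[OF D] by blast
  have "\<bar>f y - f x - (y - x) \<bullet> D x\<bar> = \<bar>(y - x) \<bullet> (D w - D x)\<bar>"
    using w by (simp add: inner_diff_right)
  also have "\<dots> \<le> norm (y - x) * norm (D w - D x)"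
    by (rule Cauchy_Schwarz_ineq2)
  also have "\<dots> \<le> norm (y - x) * (L * norm (y - x))"
  proof (rule mult_left_mono)
    have "norm (D w - D x) \<le> L * norm (w - x)"
      using lipschitz_onD[OF L, of w x] by (simp add: dist_norm)
    also have "\<dots> \<le> L * norm (y - x)"
      using w lipschitz_on_nonneg[OF L] by (intro mult_left_mono)
    finally show "norm (D w - D x) \<le> L * norm (y - x)" .
  qed simp
  finally show ?thesis
    by (simp add: power2_eq_square mult_ac)
qed

text \<open>Restriction to the line through \<open>x\<close> and \<open>y\<close> reduces the claim
  to the one-dimensional tangent inequality, read off at the parameters 0 and 1.\<close>

lemma convex_above_tangent:
  fixes f :: "'a::real_inner \<Rightarrow> real"
  assumes f: "convex_on UNIV f" and D: "GDERIV f x :> D"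
  shows "f x + (y - x) \<bullet> D \<le> f y"
proof -
  let ?k = "\<lambda>t::real. f (x + t *\<^sub>R (y - x))"
  have "convex_on UNIV ?k"
  proof (rule convex_onI)
    fix t s u :: real assume t: "0 < t" "t < 1"
    have "x + ((1 - t) *\<^sub>R s + t *\<^sub>R u) *\<^sub>R (y - x)
        = (1 - t) *\<^sub>R (x + s *\<^sub>R (y - x)) + t *\<^sub>R (x + u *\<^sub>R (y - x))"
      by (simp add: algebra_simps)
    then show "?k ((1 - t) *\<^sub>R s + t *\<^sub>R u) \<le> (1 - t) * ?k s + t * ?k u"
      using convex_onD[OF f, of t "x + s *\<^sub>R (y - x)" "x + u *\<^sub>R (y - x)"] t by simp
  qed simp
  moreover have "(?k has_real_derivative ((y - x) \<bullet> D)) (at 0)"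
    using D by (intro GDERIV_along_line) simp
  ultimately have "?k 1 - ?k 0 \<ge> ((y - x) \<bullet> D) * (1 - 0)"
    by (intro convex_on_imp_above_tangent[where A=UNIV]) auto
  then show ?thesis by simp
qed

section \<open>Proximal map of a single convex function\<close>

text \<open>The body is that of \<open>fixed_point\<close> with \<open>g \<theta>\<close> abstracted
  to \<open>f\<close>, so the convex analysis can be done without the parameter and transferred by
  unfolding.\<close>

definition prox :: "('a::real_inner \<Rightarrow> real) \<Rightarrow> 'a \<Rightarrow> 'a"
  where "prox f z = (THE y. is_arg_min (\<lambda>y. 1/2 * (norm (y - z))\<^sup>2 + f y) (\<lambda>_. True) y)"

definition prox_obj :: "('a::real_inner \<Rightarrow> real) \<Rightarrow> 'a \<Rightarrow> 'a \<Rightarrow> real"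
  where "prox_obj f z y = 1/2 * (norm (y - z))\<^sup>2 + f y"

text \<open>The quadratic term makes the proximal objective strongly convex with modulus 1.
  Comparing \<open>p\<close> with a point on the segment towards \<open>y\<close> and dividing by
  \<open>t\<close> gives the gap with a spare factor \<open>1 - t\<close>, which disappears as
  \<open>t\<close> tends to 0 from the right.\<close>

lemma prox_obj_min_gap:
  assumes f: "convex_on UNIV f" and p: "\<And>y. prox_obj f z p \<le> prox_obj f z y"
  shows "prox_obj f z p + 1/2 * (norm (y - p))\<^sup>2 \<le> prox_obj f z y"
proof -
  have *: "prox_obj f z p + 1/2 * (1 - t) * (norm (y - p))\<^sup>2 \<le> prox_obj f z y"
    if t: "0 < t" "t < 1" for t :: real
  proof -
    let ?w = "(1 - t) *\<^sub>R p + t *\<^sub>R y"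
    have w: "?w - z = (1 - t) *\<^sub>R (p - z) + t *\<^sub>R (y - z)"
      by (simp add: algebra_simps)
    have yp: "y - p = (y - z) - (p - z)" by simp
    have "(norm (?w - z))\<^sup>2 = (1 - t) * (norm (p - z))\<^sup>2 + t * (norm (y - z))\<^sup>2
        - t * (1 - t) * (norm (y - p))\<^sup>2"
      unfolding w yp power2_norm_eq_inner
      by (simp only: inner_simps inner_commute[of "y - z" "p - z"]) algebra
    moreover have "f ?w \<le> (1 - t) * f p + t * f y"
      using convex_onD[OF f, of t p y] t by simp
    ultimately have "1/2 * (norm (?w - z))\<^sup>2 + f ?w
        \<le> 1/2 * ((1 - t) * (norm (p - z))\<^sup>2 + t * (norm (y - z))\<^sup>2
            - t * (1 - t) * (norm (y - p))\<^sup>2) + ((1 - t) * f p + t * f y)"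
      by simp
    also have "\<dots> = (1 - t) * prox_obj f z p + t * prox_obj f z y
        - t * (1 - t) / 2 * (norm (y - p))\<^sup>2"
      unfolding prox_obj_def by (simp add: field_simps)
    finally have "prox_obj f z ?w \<le> (1 - t) * prox_obj f z p + t * prox_obj f z y
        - t * (1 - t) / 2 * (norm (y - p))\<^sup>2"
      by (simp only: prox_obj_def)
    with p[of ?w] have "t * (prox_obj f z p + 1/2 * (1 - t) * (norm (y - p))\<^sup>2) \<le> t * prox_obj f z y"
      by (simp add: algebra_simps)
    with t show ?thesis by simp
  qed
  have "((\<lambda>t::real. prox_obj f z p + 1/2 * (1 - t) * (norm (y - p))\<^sup>2) \<longlongrightarrow>
      prox_obj f z p + 1/2 * (1 - 0) * (norm (y - p))\<^sup>2) (at_right 0)"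
    by (intro tendsto_intros)
  moreover have "\<forall>\<^sub>F t::real in at_right 0. prox_obj f z p + 1/2 * (1 - t) * (norm (y - p))\<^sup>2 \<le> prox_obj f z y"
    using * by (auto simp: eventually_at_right_field intro!: exI[of _ 1])
  ultimately have "prox_obj f z p + 1/2 * (1 - 0) * (norm (y - p))\<^sup>2 \<le> prox_obj f z y"
    by (rule tendsto_upperbound) simp
  then show ?thesis by simp
qed

lemma prox_obj_attains_min:
  fixes f :: "'a::euclidean_space \<Rightarrow> real"
  assumes f: "convex_on UNIV f" and D: "\<And>x. GDERIV f x :> D x"
  shows "\<exists>p. \<forall>y. prox_obj f z p \<le> prox_obj f z y"
proof -
  \<comment> \<open>Outside this radius the tangent at \<open>z\<close> can fall by at most half the
    squared distance to \<open>z\<close>, which the quadratic term pays for. So \<open>z\<close> is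
    no worse than any far point, and a minimum over the compact ball is global.\<close>
  let ?r = "2 * norm (D z)"
  have "continuous_on UNIV f"
    using D unfolding gderiv_def by (meson continuous_on_eq_continuous_at has_derivative_continuous open_UNIV)
  then have "continuous_on (cball z ?r) (prox_obj f z)"
    unfolding prox_obj_def by (intro continuous_intros) (auto intro: continuous_on_subset)
  then obtain p where p: "p \<in> cball z ?r" "\<And>y. y \<in> cball z ?r \<Longrightarrow> prox_obj f z p \<le> prox_obj f z y"
    using continuous_attains_inf[of "cball z ?r" "prox_obj f z"] by auto
  have "prox_obj f z p \<le> prox_obj f z y" if "y \<notin> cball z ?r" for y
  proof -
    have far: "?r \<le> norm (y - z)"
      using that by (simp add: dist_norm norm_minus_commute)
    have "prox_obj f z p \<le> prox_obj f z z"
      by (intro p) simp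
    also have "\<dots> = f z" by (simp add: prox_obj_def)
    also have "f z \<le> f y - (y - z) \<bullet> D z"
      using convex_above_tangent[OF f D, of z y] by simp
    also have "\<dots> \<le> f y + norm (y - z) * norm (D z)"
      using Cauchy_Schwarz_ineq2[of "y - z" "D z"] by simp
    also have "\<dots> \<le> f y + norm (y - z) * (norm (y - z) / 2)"
      using far by (intro add_left_mono mult_left_mono) auto
    finally show ?thesis by (simp add: prox_obj_def power2_eq_square)
  qed
  with p show ?thesis by blast
qed

lemma prox_min:
  fixes f :: "'a::euclidean_space \<Rightarrow> real"
  assumes f: "convex_on UNIV f" and D: "\<And>x. GDERIV f x :> D x"
  shows "prox_obj f z (prox f z) \<le> prox_obj f z y"
proof -
  obtain p where p: "\<And>y. prox_obj f z p \<le> prox_obj f z y"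
    using prox_obj_attains_min[OF f D] by blast
  \<comment> \<open>The gap makes the minimizer unique, so the definite description in
    \<open>prox\<close> denotes it.\<close>
  have "q = p" if "\<And>y. prox_obj f z q \<le> prox_obj f z y" for q
  proof -
    have "(norm (q - p))\<^sup>2 \<le> 0"
      using prox_obj_min_gap[OF f p, of q] that[of p] by linarith
    then show ?thesis by simp
  qed
  then have "prox f z = p"
    using p unfolding prox_def prox_obj_def
    by (intro the_equality) (auto simp: is_arg_min_linorder)
  with p show ?thesis by simp
qed

lemma prox_gap:
  fixes f :: "'a::euclidean_space \<Rightarrow> real"
  assumes f: "convex_on UNIV f" and D: "\<And>x. GDERIV f x :> D x"
  shows "prox_obj f z (prox f z) + 1/2 * (norm (y - prox f z))\<^sup>2 \<le> prox_obj f z y"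
  by (rule prox_obj_min_gap[OF f prox_min[OF f D]])

lemma GDERIV_prox_obj:
  assumes "GDERIV f y :> D"
  shows "GDERIV (prox_obj f z) y :> (y - z) + D"
proof -
  have "(f has_derivative (\<lambda>h. h \<bullet> D)) (at y)"
    using assms by (simp add: gderiv_def)
  then have "((\<lambda>y. 1/2 * ((y - z) \<bullet> (y - z)) + f y) has_derivative (\<lambda>h. h \<bullet> ((y - z) + D))) (at y)"
    by (auto intro!: derivative_eq_intros simp: inner_add_right inner_commute)
  then show ?thesis
    by (simp add: gderiv_def prox_obj_def[abs_def] power2_norm_eq_inner)
qed

lemma prox_stationary:
  fixes f :: "'a::euclidean_space \<Rightarrow> real"
  assumes f: "convex_on UNIV f" and D: "\<And>x. GDERIV f x :> D x"
  shows "(prox f z - z) + D (prox f z) = 0"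
proof -
  let ?v = "(prox f z - z) + D (prox f z)"
  have "(\<lambda>h. h \<bullet> ?v) = (\<lambda>h. 0)"
    using GDERIV_prox_obj[OF D, of z "prox f z"] unfolding gderiv_def
    by (rule differential_zero_maxmin[where S=UNIV, rotated 2]) (auto intro: prox_min[OF f D])
  then have "?v \<bullet> ?v = 0" by (rule fun_cong)
  then show ?thesis by simp
qed

text \<open>The gap at the minimizer and the tangent inequality of \<open>f\<close> at
  \<open>w\<close> each contribute half the squared distance. Their sum bounds that square by the
  inner product of \<open>w - ?p\<close> with the residual. This converts a residual tolerance into
  a distance to the exact fixed point.\<close>

lemma prox_residual_bound:
  fixes f :: "'a::euclidean_space \<Rightarrow> real"
  assumes f: "convex_on UNIV f" and D: "\<And>x. GDERIV f x :> D x"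
  shows "norm (w - prox f z) \<le> norm ((w - z) + D w)"
proof -
  let ?p = "prox f z" and ?r = "(w - z) + D w"
  have pz: "?p - z = (?p - w) + (w - z)" by simp
  have "(norm (?p - z))\<^sup>2 = (norm (w - z))\<^sup>2 + 2 * ((?p - w) \<bullet> (w - z)) + (norm (?p - w))\<^sup>2"
    unfolding pz power2_norm_eq_inner by (simp only: inner_simps inner_commute) algebra
  with convex_above_tangent[OF f D, of w ?p]
  have "prox_obj f z w + (?p - w) \<bullet> ?r + 1/2 * (norm (?p - w))\<^sup>2 \<le> prox_obj f z ?p"
    unfolding prox_obj_def inner_add_right by argo
  with prox_gap[OF f D, of z w] have "(norm (w - ?p))\<^sup>2 \<le> (w - ?p) \<bullet> ?r"
    by (simp add: norm_minus_commute inner_diff_left)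
  also have "\<dots> \<le> norm (w - ?p) * norm ?r"
    by (rule norm_cauchy_schwarz)
  finally show ?thesis
    by (cases "w = ?p") (auto simp: power2_eq_square)
qed

text \<open>Regarded as an approximate solution for \<open>z'\<close>, the exact solution for
  \<open>z\<close> has residual \<open>z - z'\<close>.\<close>

lemma prox_nonexpansive:
  fixes f :: "'a::euclidean_space \<Rightarrow> real"
  assumes f: "convex_on UNIV f" and D: "\<And>x. GDERIV f x :> D x"
  shows "norm (prox f z - prox f z') \<le> norm (z - z')"
proof -
  have "(prox f z - z') + D (prox f z) = z - z'"
    using prox_stationary[OF f D, of z] by (simp add: algebra_simps)
  then show ?thesis
    using prox_residual_bound[OF f D, of "prox f z" z'] by metis
qed

text \<open>Each minimizer is tested in the other problem. When the two gaps are added, the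
  quadratic terms centred at \<open>z\<close> cancel, and only the variation of
  \<open>f' - f\<close> between the minimizers remains.\<close>

lemma prox_perturbation:
  fixes f :: "'a::euclidean_space \<Rightarrow> real"
  assumes f: "convex_on UNIV f" "\<And>x. GDERIV f x :> D x"
    and f': "convex_on UNIV f'" "\<And>x. GDERIV f' x :> D' x"
    and C: "\<And>x y. \<bar>(f' x - f x) - (f' y - f y)\<bar> \<le> C * norm (x - y)"
  shows "norm (prox f' z - prox f z) \<le> C"
proof -
  let ?p = "prox f z" and ?q = "prox f' z"
  have "(norm (?q - ?p))\<^sup>2 \<le> (f' ?p - f ?p) - (f' ?q - f ?q)"
    using prox_gap[OF f, of z ?q] prox_gap[OF f', of z ?p]
    by (simp add: prox_obj_def norm_minus_commute)
  also have "\<dots> \<le> C * norm (?q - ?p)"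
    using C[of ?p ?q] by (simp add: norm_minus_commute)
  finally have "(norm (?q - ?p))\<^sup>2 \<le> C * norm (?q - ?p)" .
  moreover have "0 \<le> C" if "norm (?q - ?p) \<noteq> 0"
    using C[of ?q ?p] that by (smt (verit) mult_neg_pos norm_ge_zero)
  \<comment> \<open>If the minimizers coincide, the claim is \<open>0 \<le> C\<close>; it follows
    from the hypothesis at two points that differ by a unit basis vector.\<close>
  ultimately show ?thesis
    using C[of ?p "?p + (SOME b. b \<in> Basis)"]
    by (cases "?q = ?p") (auto simp: power2_eq_square some_in_eq)
qed

section \<open>Differentiation under the expectation and moment bounds\<close>

lemma GDERIV_quadratic_remainder:
  assumes C: "\<And>h. \<bar>f (x + h) - f x - h \<bullet> D\<bar> \<le> C * (norm h)\<^sup>2"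
  shows "GDERIV f x :> D"
  unfolding gderiv_def has_derivative_at
proof (intro conjI bounded_linear_inner_left)
  have lim: "((\<lambda>h::'a. C * norm h) \<longlongrightarrow> 0) (at 0)"
    by (intro tendsto_mult_right_zero tendsto_norm_zero tendsto_ident_at)
  have "norm (f (x + h) - f x - h \<bullet> D) / norm h \<le> C * norm h" for h
    using C[of h] by (cases "h = 0") (auto simp: field_simps power2_eq_square)
  then show "((\<lambda>h. norm (f (x + h) - f x - h \<bullet> D) / norm h) \<longlongrightarrow> 0) (at 0)"
    by (intro tendsto_sandwich[OF _ _ tendsto_const lim]) auto
qed

text \<open>As \<open>C\<close> is the same for all \<open>z\<close>, the quadratic remainder bound
  survives integration against a measure of mass 1.\<close>

lemma (in prob_space) GDERIV_integral:
  fixes f :: "'b::euclidean_space \<Rightarrow> 'a \<Rightarrow> real"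
  assumes f: "\<And>t. integrable M (f t)" and D: "integrable M D"
    and C: "\<And>h z. \<bar>f (x + h) z - f x z - h \<bullet> D z\<bar> \<le> C * (norm h)\<^sup>2"
  shows "GDERIV (\<lambda>t. \<integral>z. f t z \<partial>M) x :> (\<integral>z. D z \<partial>M)"
proof (rule GDERIV_quadratic_remainder)
  fix h
  have int: "integrable M (\<lambda>z. f (x + h) z - f x z - h \<bullet> D z)"
    using f D by (intro Bochner_Integration.integrable_diff integrable_inner_right) auto
  have "(\<integral>z. f (x + h) z \<partial>M) - (\<integral>z. f x z \<partial>M) - h \<bullet> (\<integral>z. D z \<partial>M)
      = (\<integral>z. f (x + h) z - f x z - h \<bullet> D z \<partial>M)"
    using f D by (simp add: integral_inner_right)
  also have "\<bar>\<dots>\<bar> \<le> (\<integral>z. \<bar>f (x + h) z - f x z - h \<bullet> D z\<bar> \<partial>M)"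
    by (rule integral_abs_bound)
  also have "\<dots> \<le> (\<integral>z. C * (norm h)\<^sup>2 \<partial>M)"
    using C by (intro integral_mono integrable_abs int) auto
  finally show "\<bar>(\<integral>z. f (x + h) z \<partial>M) - (\<integral>z. f x z \<partial>M) - h \<bullet> (\<integral>z. D z \<partial>M)\<bar> \<le> C * (norm h)\<^sup>2"
    by (simp add: prob_space)
qed

text \<open>The variance of \<open>norm (f x)\<close> is nonnegative, so its squared mean is at most
  its second moment.\<close>

lemma (in prob_space) norm_integral_le_sqrt:
  fixes f :: "'a \<Rightarrow> 'b::euclidean_space"
  assumes f: "f \<in> borel_measurable M" and sq: "integrable M (\<lambda>x. (norm (f x))\<^sup>2)"
    and C: "(\<integral>x. (norm (f x))\<^sup>2 \<partial>M) \<le> C"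
  shows "norm (\<integral>x. f x \<partial>M) \<le> sqrt C"
proof -
  have int: "integrable M (\<lambda>x. norm (f x))"
    using measurable_compose[OF f borel_measurable_norm] sq by (rule square_integrable_imp_integrable)
  have "norm (\<integral>x. f x \<partial>M) \<le> (\<integral>x. norm (f x) \<partial>M)"
    by (rule integral_norm_bound)
  moreover have "(\<integral>x. norm (f x) \<partial>M)\<^sup>2 \<le> C"
    using variance_positive[of "\<lambda>x. norm (f x)"] variance_eq[OF int sq] C by linarith
  ultimately show ?thesis
    by (rule order_trans[OF _ real_le_rsqrt])
qed

lemma (in finite_measure) integrable_quadratic_growth:
  fixes f :: "'a \<Rightarrow> 'b::euclidean_space" and u :: "'a \<Rightarrow> real"
  assumes f: "f \<in> borel_measurable M" and u: "integrable M (\<lambda>x. (u x)\<^sup>2)"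
    and bound: "\<And>x. norm (f x) \<le> a + b * (u x)\<^sup>2"
  shows "integrable M f"
proof (rule Bochner_Integration.integrable_bound[OF _ f])
  show "integrable M (\<lambda>x. a + b * (u x)\<^sup>2)" using u by simp
  show "AE x in M. norm (f x) \<le> norm (a + b * (u x)\<^sup>2)"
    using bound by (intro AE_I2) (smt (verit) real_norm_def)
qed

text \<open>The bound depends on \<open>f\<close> only through \<open>a\<close> and
  \<open>b\<close>, so one moment constant can serve every approximate fixed point.\<close>

lemma (in finite_measure) square_integral_linear_growth:
  fixes f :: "'a \<Rightarrow> 'b::euclidean_space" and u :: "'a \<Rightarrow> real"
  assumes f: "f \<in> borel_measurable M" and u: "integrable M (\<lambda>x. (u x)\<^sup>2)"
    and bound: "\<And>x. norm (f x) \<le> a + b * u x"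
  shows "integrable M (\<lambda>x. (norm (f x))\<^sup>2)"
    and "(\<integral>x. (norm (f x))\<^sup>2 \<partial>M) \<le> (\<integral>x. 2 * a\<^sup>2 + 2 * b\<^sup>2 * (u x)\<^sup>2 \<partial>M)"
proof -
  have bd: "(norm (f x))\<^sup>2 \<le> 2 * a\<^sup>2 + 2 * b\<^sup>2 * (u x)\<^sup>2" for x
  proof -
    have "(norm (f x))\<^sup>2 \<le> (a + b * u x)\<^sup>2"
      using bound by (intro power_mono) auto
    also have "\<dots> \<le> 2 * a\<^sup>2 + 2 * (b * u x)\<^sup>2"
      using zero_le_power2[of "a - b * u x"] by (simp add: power2_sum power2_diff)
    finally show ?thesis by (simp add: power_mult_distrib)
  qed
  show int: "integrable M (\<lambda>x. (norm (f x))\<^sup>2)"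
    using f bd by (intro integrable_quadratic_growth[OF _ u, where a="2 * a\<^sup>2" and b="2 * b\<^sup>2"]) auto
  show "(\<integral>x. (norm (f x))\<^sup>2 \<partial>M) \<le> (\<integral>x. 2 * a\<^sup>2 + 2 * b\<^sup>2 * (u x)\<^sup>2 \<partial>M)"
    using u bd by (intro integral_mono int) auto
qed

lemma lipschitz_linear_growth:
  fixes f :: "'a::real_normed_vector \<Rightarrow> 'b::real_normed_vector"
  assumes "L-lipschitz_on UNIV f"
  shows "norm (f x) \<le> norm (f 0) + L * norm x"
  using lipschitz_onD[OF assms, of x 0] norm_triangle_ineq[of "f 0" "f x - f 0"]
  by (simp add: dist_norm)

lemma lipschitz_borel_measurable:
  fixes f :: "'a::real_normed_vector \<Rightarrow> 'b::real_normed_vector"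
  assumes "L-lipschitz_on UNIV f"
  shows "f \<in> borel_measurable borel"
  using lipschitz_on_continuous_on[OF assms] by (rule borel_measurable_continuous_onI)

lemma second_moment_less_integrable:
  assumes "prob_space M" "f \<in> borel_measurable M" "second_moment_less M f C"
  shows "integrable M f"
proof -
  interpret prob_space M by fact
  have "integrable M (\<lambda>x. norm (f x))"
  proof (rule square_integrable_imp_integrable)
    show "integrable M (\<lambda>x. (norm (f x))\<^sup>2)"
      using assms(3) by (simp add: second_moment_less_def)
  qed (use assms(2) in simp)
  with assms(2) show ?thesis by (simp add: integrable_norm_iff)
qed

section \<open>Parametrized potentials: fixed points and the envelope\<close>

text \<open>The Lipschitz bound in \<open>\<theta>\<close> controls the Taylor remainder; the one in
  \<open>y\<close> controls the motion of the fixed point and the cost of computing it inexactly.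
  \<open>K\<close> yields quadratic growth, hence integrability.\<close>

locale smooth_convex_potential =
  fixes g :: "real^'p \<Rightarrow> real^'d \<Rightarrow> real" and L K :: real
  assumes convex: "\<And>\<theta>. convex_on UNIV (g \<theta>)"
    and C1: "continuously_differentiable (\<lambda>(\<theta>, y). g \<theta> y)"
    and lipschitz_param: "\<And>y. L-lipschitz_on UNIV (\<lambda>\<theta>. grad_param g \<theta> y)"
      "\<And>\<theta>. L-lipschitz_on UNIV (\<lambda>y. grad_param g \<theta> y)"
    and lipschitz_space: "\<And>\<theta>. K-lipschitz_on UNIV (\<lambda>y. grad_space g \<theta> y)"
begin

lemma L_nonneg: "0 \<le> L"
  using lipschitz_on_nonneg[OF lipschitz_param(1)] .

text \<open>Composing the joint derivative with the two slices through \<open>(\<theta>, y)\<close>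
  shows that the partial gradients are the components of the joint gradient.\<close>

lemma GDERIV_param: "GDERIV (\<lambda>t. g t y) \<theta> :> grad_param g \<theta> y"
  and GDERIV_space: "GDERIV (g \<theta>) y :> grad_space g \<theta> y"
proof -
  obtain D where "GDERIV (\<lambda>(\<theta>, y). g \<theta> y) (\<theta>, y) :> D"
    using C1 unfolding continuously_differentiable_def by blast
  then have D: "((\<lambda>(\<theta>, y). g \<theta> y) has_derivative (\<lambda>h. h \<bullet> D)) (at (\<theta>, y))"
    by (simp add: gderiv_def)
  have "((\<lambda>t. (t, y)) has_derivative (\<lambda>h. (h, 0))) (at \<theta>)"
    by (auto intro!: derivative_eq_intros)
  from has_derivative_compose[OF this D]
  have 1: "GDERIV (\<lambda>t. g t y) \<theta> :> fst D"
    by (simp add: gderiv_def inner_prod_def)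
  have "((\<lambda>y. (\<theta>, y)) has_derivative (\<lambda>h. (0, h))) (at y)"
    by (auto intro!: derivative_eq_intros)
  from has_derivative_compose[OF this D]
  have 2: "GDERIV (g \<theta>) y :> snd D"
    by (simp add: gderiv_def inner_prod_def)
  show "GDERIV (\<lambda>t. g t y) \<theta> :> grad_param g \<theta> y"
    using 1 grad_eqI[OF 1] by (simp add: grad_param_def)
  show "GDERIV (g \<theta>) y :> grad_space g \<theta> y"
    using 2 grad_eqI[OF 2] by (simp add: grad_space_def)
qed

lemma grad_param_dist: "norm (grad_param g \<theta> x - grad_param g \<theta> y) \<le> L * norm (x - y)"
  using lipschitz_onD[OF lipschitz_param(2), of x y] by (simp add: dist_norm)

lemma fixed_point_eq_prox: "fixed_point g \<theta> z = prox (g \<theta>) z"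
  by (simp add: fixed_point_def prox_def)

lemma fixed_point_lipschitz: "1-lipschitz_on UNIV (fixed_point g \<theta>)"
  using prox_nonexpansive[OF convex GDERIV_space]
  by (intro lipschitz_onI) (auto simp: fixed_point_eq_prox dist_norm)

lemma fixed_point_param_lipschitz:
  "norm (fixed_point g (\<theta> + h) z - fixed_point g \<theta> z) \<le> L * norm h"
  unfolding fixed_point_eq_prox
proof (rule prox_perturbation[OF convex GDERIV_space convex GDERIV_space])
  fix x y
  \<comment> \<open>The mixed difference is regrouped by parameter, so that the mean value theorem
    in \<open>t\<close> leaves a difference of parameter gradients at \<open>x\<close> and
    \<open>y\<close>.\<close>
  have "GDERIV (\<lambda>t. g t x - g t y) t :> grad_param g t x - grad_param g t y" for t
    by (intro GDERIV_diff GDERIV_param)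
  then obtain w where "(g (\<theta> + h) x - g (\<theta> + h) y) - (g \<theta> x - g \<theta> y)
      = (\<theta> + h - \<theta>) \<bullet> (grad_param g w x - grad_param g w y)"
    using GDERIV_mvt[of "\<lambda>t. g t x - g t y" "\<lambda>t. grad_param g t x - grad_param g t y" \<theta> "\<theta> + h"]
    by blast
  then have "\<bar>(g (\<theta> + h) x - g \<theta> x) - (g (\<theta> + h) y - g \<theta> y)\<bar>
      = \<bar>h \<bullet> (grad_param g w x - grad_param g w y)\<bar>"
    by simp
  also have "\<dots> \<le> norm h * norm (grad_param g w x - grad_param g w y)"
    by (rule Cauchy_Schwarz_ineq2)
  also have "\<dots> \<le> norm h * (L * norm (x - y))"
    by (intro mult_left_mono grad_param_dist) simp
  finally show "\<bar>(g (\<theta> + h) x - g \<theta> x) - (g (\<theta> + h) y - g \<theta> y)\<bar> \<le> L * norm h * norm (x - y)"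
    by (simp add: mult_ac)
qed

lemma param_remainder: "\<bar>g (\<theta> + h) y - g \<theta> y - h \<bullet> grad_param g \<theta> y\<bar> \<le> L * (norm h)\<^sup>2"
  using lipschitz_gradient_remainder[OF GDERIV_param lipschitz_param(1), of "\<theta> + h" y \<theta>] by simp

text \<open>The upper bound tests the old minimizer in the new problem, the lower bound the new
  minimizer in the old one. The latter produces the gradient at \<open>?q\<close> instead of
  \<open>?p\<close>; since the fixed point moves by at most \<open>L * norm h\<close>, the
  correction costs the term with \<open>L\<^sup>2\<close>.\<close>

lemma envelope_remainder:
  defines "F \<equiv> \<lambda>\<theta> z. prox_obj (g \<theta>) z (fixed_point g \<theta> z)"
  shows "\<bar>F (\<theta> + h) z - F \<theta> z - h \<bullet> grad_param g \<theta> (fixed_point g \<theta> z)\<bar>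
    \<le> (L + L\<^sup>2) * (norm h)\<^sup>2"
proof -
  let ?p = "fixed_point g \<theta> z" and ?q = "fixed_point g (\<theta> + h) z" and ?G = "grad_param g \<theta>"
  have min: "F t z \<le> prox_obj (g t) z y" for t y
    unfolding F_def fixed_point_eq_prox by (rule prox_min[OF convex GDERIV_space])
  have "F (\<theta> + h) z - F \<theta> z \<le> g (\<theta> + h) ?p - g \<theta> ?p"
    using min[of "\<theta> + h" ?p] by (simp add: F_def prox_obj_def)
  then have upper: "F (\<theta> + h) z - F \<theta> z - h \<bullet> ?G ?p \<le> L * (norm h)\<^sup>2"
    using param_remainder[of \<theta> h ?p] by simp
  have "g (\<theta> + h) ?q - g \<theta> ?q \<le> F (\<theta> + h) z - F \<theta> z"
    using min[of \<theta> ?q] by (simp add: F_def prox_obj_def)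
  then have "h \<bullet> (?G ?q - ?G ?p) - L * (norm h)\<^sup>2 \<le> F (\<theta> + h) z - F \<theta> z - h \<bullet> ?G ?p"
    using param_remainder[of \<theta> h ?q] by (simp add: inner_diff_right)
  moreover have "\<bar>h \<bullet> (?G ?q - ?G ?p)\<bar> \<le> L\<^sup>2 * (norm h)\<^sup>2"
  proof -
    have "\<bar>h \<bullet> (?G ?q - ?G ?p)\<bar> \<le> norm h * norm (?G ?q - ?G ?p)"
      by (rule Cauchy_Schwarz_ineq2)
    also have "norm (?G ?q - ?G ?p) \<le> L * (L * norm h)"
      using grad_param_dist fixed_point_param_lipschitz L_nonneg
      by (meson mult_left_mono order_trans)
    then have "norm h * norm (?G ?q - ?G ?p) \<le> norm h * (L * (L * norm h))"
      by (intro mult_left_mono) auto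
    finally show ?thesis by (simp add: power2_eq_square mult_ac)
  qed
  moreover have "0 \<le> L\<^sup>2 * (norm h)\<^sup>2" by simp
  ultimately show ?thesis
    using upper unfolding distrib_right by linarith
qed

lemma potential_quadratic_growth: "\<exists>a b. 0 \<le> b \<and> (\<forall>y. \<bar>g \<theta> y\<bar> \<le> a + b * (norm y)\<^sup>2)"
proof (intro exI conjI allI)
  let ?d = "norm (grad_space g \<theta> 0)"
  show "0 \<le> ?d + K" using lipschitz_on_nonneg[OF lipschitz_space] by simp
  fix y :: "real^'d"
  \<comment> \<open>This absorbs the linear Taylor term into the quadratic growth.\<close>
  have "norm y \<le> 1 + (norm y)\<^sup>2"
    using zero_le_power2[of "norm y - 1"] norm_ge_zero[of y]
    unfolding power2_diff one_power2 mult_1_right by linarith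
  then have "norm y * ?d \<le> (1 + (norm y)\<^sup>2) * ?d"
    by (intro mult_right_mono) auto
  moreover have "\<bar>y \<bullet> grad_space g \<theta> 0\<bar> \<le> norm y * ?d"
    by (rule Cauchy_Schwarz_ineq2)
  moreover have "\<bar>g \<theta> y - g \<theta> 0 - y \<bullet> grad_space g \<theta> 0\<bar> \<le> K * (norm y)\<^sup>2"
    using lipschitz_gradient_remainder[OF GDERIV_space lipschitz_space, of \<theta> y 0] by simp
  ultimately show "\<bar>g \<theta> y\<bar> \<le> (\<bar>g \<theta> 0\<bar> + ?d) + (?d + K) * (norm y)\<^sup>2"
    by (simp add: algebra_simps)
qed

lemma potential_measurable: "g \<theta> \<in> borel_measurable borel"
proof (rule borel_measurable_continuous_onI)
  show "continuous_on UNIV (g \<theta>)"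
    using GDERIV_space unfolding gderiv_def
    by (meson continuous_on_eq_continuous_at has_derivative_continuous open_UNIV)
qed

section \<open>Integrability and existence of the moment constants\<close>

lemma integrable_potential:
  assumes "prob_space M" "sets M = sets borel" "integrable M (\<lambda>x. (norm x)\<^sup>2)"
  shows "integrable M (g \<theta>)"
proof -
  interpret prob_space M by fact
  obtain a b where "\<And>y. \<bar>g \<theta> y\<bar> \<le> a + b * (norm y)\<^sup>2"
    using potential_quadratic_growth by blast
  then show ?thesis
    using potential_measurable
    by (intro integrable_quadratic_growth[OF _ assms(3)])
       (auto simp: measurable_cong_sets[OF assms(2) refl])
qed

lemma integrable_envelope:
  assumes "prob_space M" "sets M = sets borel" "integrable M (\<lambda>x. (norm x)\<^sup>2)"
  shows "integrable M (\<lambda>z. prox_obj (g \<theta>) z (fixed_point g \<theta> z))"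
proof -
  interpret prob_space M by fact
  let ?p = "fixed_point g \<theta>"
  obtain a b where b: "0 \<le> b" and g: "\<And>y. \<bar>g \<theta> y\<bar> \<le> a + b * (norm y)\<^sup>2"
    using potential_quadratic_growth by blast
  have [measurable]: "?p \<in> borel_measurable borel" "g \<theta> \<in> borel_measurable borel"
    by (rule lipschitz_borel_measurable[OF fixed_point_lipschitz] potential_measurable)+
  \<comment> \<open>The fixed point is nonexpansive in \<open>z\<close> and so grows at most
    linearly. The constants come from bounding the square of a sum by twice the sum of squares, for
    \<open>?p z - z\<close> and then for \<open>?p z\<close>.\<close>
  have "norm (prox_obj (g \<theta>) z (?p z))
      \<le> (a + (1 + b) * (2 * (norm (?p 0))\<^sup>2)) + (1 + (1 + b) * 2) * (norm z)\<^sup>2" for z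
  proof -
    have "(norm (?p z))\<^sup>2 \<le> (norm (?p 0) + norm z)\<^sup>2"
      using lipschitz_linear_growth[OF fixed_point_lipschitz, of \<theta> z] by (intro power_mono) auto
    also have "\<dots> \<le> 2 * (norm (?p 0))\<^sup>2 + 2 * (norm z)\<^sup>2"
      using zero_le_power2[of "norm (?p 0) - norm z"] by (simp add: power2_sum power2_diff)
    finally have p: "(1 + b) * (norm (?p z))\<^sup>2 \<le> (1 + b) * (2 * (norm (?p 0))\<^sup>2 + 2 * (norm z)\<^sup>2)"
      using b by (intro mult_left_mono) auto
    have "(norm (?p z - z))\<^sup>2 \<le> (norm (?p z) + norm z)\<^sup>2"
      by (intro power_mono norm_triangle_ineq4) auto
    also have "\<dots> \<le> 2 * (norm (?p z))\<^sup>2 + 2 * (norm z)\<^sup>2"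
      using zero_le_power2[of "norm (?p z) - norm z"] by (simp add: power2_sum power2_diff)
    finally have "norm (prox_obj (g \<theta>) z (?p z)) \<le> (norm (?p z))\<^sup>2 + (norm z)\<^sup>2 + (a + b * (norm (?p z))\<^sup>2)"
      using g[of "?p z"] zero_le_power2[of "norm (?p z - z)"] unfolding prox_obj_def real_norm_def by linarith
    with p show ?thesis by (simp add: algebra_simps)
  qed
  moreover have "(\<lambda>z. prox_obj (g \<theta>) z (?p z)) \<in> borel_measurable M"
    unfolding prox_obj_def measurable_cong_sets[OF assms(2) refl] by measurable
  ultimately show ?thesis
    by (intro integrable_quadratic_growth[OF _ assms(3)])
qed

lemma grad_param_measurable: "grad_param g \<theta> \<in> borel_measurable borel"
  by (rule lipschitz_borel_measurable[OF lipschitz_param(2)])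

text \<open>By stationarity the residual is 0, so the bound by \<open>Mz\<close> is also available
  at the exact fixed point.\<close>

lemma approx_fixed_point_exact:
  assumes "sets \<nu> = sets borel" "0 < \<epsilon>p"
  shows "approx_fixed_point \<nu> g \<epsilon>p \<theta> (fixed_point g \<theta>)"
  using assms lipschitz_borel_measurable[OF fixed_point_lipschitz]
    prox_stationary[OF convex GDERIV_space]
  by (simp add: approx_fixed_point_def fixed_point_eq_prox measurable_cong_sets[OF assms(1) refl])

lemma moment_constants_exist:
  assumes \<mu>: "prob_space \<mu>" "sets \<mu> = sets borel" "integrable \<mu> (\<lambda>x. (norm x)\<^sup>2)"
    and \<nu>: "prob_space \<nu>" "sets \<nu> = sets borel" "integrable \<nu> (\<lambda>z. (norm z)\<^sup>2)"
  shows "\<exists>Mx Mz. moment_constants \<mu> \<nu> g \<epsilon>p \<theta> Mx Mz"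
proof -
  interpret mu: prob_space \<mu> by fact
  interpret nu: prob_space \<nu> by fact
  let ?G = "grad_param g \<theta>" and ?p = "fixed_point g \<theta>"
  \<comment> \<open>Every admissible \<open>w z\<close> lies within \<open>\<epsilon>p\<close> of
    the exact fixed point, whose norm is at most \<open>norm (?p 0) + norm z\<close>. Hence
    \<open>a\<close> does not depend on \<open>w\<close>.\<close>
  define a where "a = norm (?G 0) + L * (\<epsilon>p + norm (?p 0))"
  \<comment> \<open>Adding 1 here and in \<open>Mz\<close> gives both positivity and the strict
    inequality.\<close>
  define Mx where "Mx = (\<integral>x. (norm (?G x))\<^sup>2 \<partial>\<mu>) + 1"
  define Mz where "Mz = (\<integral>z. 2 * a\<^sup>2 + 2 * L\<^sup>2 * (norm z)\<^sup>2 \<partial>\<nu>) + 1"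
  note G_meas = grad_param_measurable
  have "?G \<in> borel_measurable \<mu>"
    using G_meas by (simp add: measurable_cong_sets[OF \<mu>(2) refl])
  then have "integrable \<mu> (\<lambda>x. (norm (?G x))\<^sup>2)"
    by (rule mu.square_integral_linear_growth(1)[OF _ \<mu>(3) lipschitz_linear_growth[OF lipschitz_param(2)]])
  then have x: "second_moment_less \<mu> ?G Mx"
    by (simp add: second_moment_less_def Mx_def)
  have z: "second_moment_less \<nu> (\<lambda>z. ?G (w z)) Mz" if w: "approx_fixed_point \<nu> g \<epsilon>p \<theta> w" for w
  proof -
    have meas: "(\<lambda>z. ?G (w z)) \<in> borel_measurable \<nu>"
      using w G_meas by (auto simp: approx_fixed_point_def intro: measurable_compose)
    have growth: "norm (?G (w z)) \<le> a + L * norm z" for z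
    proof -
      have "norm (w z - ?p z) \<le> \<epsilon>p"
        using prox_residual_bound[OF convex GDERIV_space, of "w z" \<theta> z] w
        unfolding approx_fixed_point_def fixed_point_eq_prox by (meson less_imp_le order_trans)
      then have "norm (w z) \<le> \<epsilon>p + norm (?p 0) + norm z"
        using lipschitz_linear_growth[OF fixed_point_lipschitz, of \<theta> z]
          norm_triangle_ineq[of "w z - ?p z" "?p z"] by simp
      then have "L * norm (w z) \<le> L * (\<epsilon>p + norm (?p 0) + norm z)"
        using L_nonneg by (intro mult_left_mono)
      then show ?thesis
        using lipschitz_linear_growth[OF lipschitz_param(2), of \<theta> "w z"]
        by (simp add: a_def algebra_simps)
    qed
    show ?thesis
      using nu.square_integral_linear_growth[OF meas \<nu>(3) growth]
      by (simp add: second_moment_less_def Mz_def)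
  qed
  have "0 < Mx" "0 < Mz"
    unfolding Mx_def Mz_def by (intro add_nonneg_pos integral_nonneg; simp)+
  with x z have "moment_constants \<mu> \<nu> g \<epsilon>p \<theta> Mx Mz"
    by (simp add: moment_constants_def)
  then show ?thesis by blast
qed

section \<open>Gradient of the objective and the descent inequality\<close>

text \<open>To first order the motion of the fixed point contributes nothing, so the second
  expectation is differentiated as if the fixed point were frozen.\<close>

lemma grad_objective:
  assumes \<mu>: "prob_space \<mu>" "sets \<mu> = sets borel" "integrable \<mu> (\<lambda>x. (norm x)\<^sup>2)"
    and \<nu>: "prob_space \<nu>" "sets \<nu> = sets borel" "integrable \<nu> (\<lambda>z. (norm z)\<^sup>2)"
    and G: "integrable \<mu> (grad_param g \<theta>)" "integrable \<nu> (\<lambda>z. grad_param g \<theta> (fixed_point g \<theta> z))"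
  shows "grad (objective \<mu> \<nu> g) \<theta>
    = (\<integral>x. grad_param g \<theta> x \<partial>\<mu>) - (\<integral>z. grad_param g \<theta> (fixed_point g \<theta> z) \<partial>\<nu>)"
proof -
  have "GDERIV (\<lambda>t. \<integral>x. g t x \<partial>\<mu>) \<theta> :> (\<integral>x. grad_param g \<theta> x \<partial>\<mu>)"
    by (rule prob_space.GDERIV_integral[OF \<mu>(1) integrable_potential[OF \<mu>] G(1) param_remainder])
  moreover have "GDERIV (\<lambda>t. \<integral>z. prox_obj (g t) z (fixed_point g t z) \<partial>\<nu>) \<theta>
      :> (\<integral>z. grad_param g \<theta> (fixed_point g \<theta> z) \<partial>\<nu>)"
    by (rule prob_space.GDERIV_integral[OF \<nu>(1) integrable_envelope[OF \<nu>] G(2) envelope_remainder])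
  ultimately show ?thesis
    unfolding objective_def[abs_def] prox_obj_def by (intro grad_eqI GDERIV_diff)
qed

text \<open>The inner product is \<open>(norm ?D)\<^sup>2\<close> minus that of \<open>?D\<close>
  with the error \<open>?D - ?A\<close>. Cauchy-Schwarz bounds the subtracted term by
  \<open>norm ?D * (L * \<epsilon>)\<close>; replacing \<open>norm ?D\<close> by
  \<open>sqrt Mx + sqrt Mz\<close> matches the denominator of the tolerance.\<close>

lemma approx_grad_descent:
  assumes \<mu>: "prob_space \<mu>" "sets \<mu> = sets borel" "integrable \<mu> (\<lambda>x. (norm x)\<^sup>2)"
    and \<nu>: "prob_space \<nu>" "sets \<nu> = sets borel" "integrable \<nu> (\<lambda>z. (norm z)\<^sup>2)"
    and "0 < \<epsilon>p"
    and residual: "approx_fixed_point \<nu> g \<epsilon>p \<theta> (ytilde \<theta>)"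
    and M: "moment_constants \<mu> \<nu> g \<epsilon>p \<theta> Mx Mz"
    and close: "\<And>z. norm (ytilde \<theta> z - fixed_point g \<theta> z) < \<epsilon>"
    and \<epsilon>: "\<epsilon> \<le> V * (norm (grad (objective \<mu> \<nu> g) \<theta>))\<^sup>2 / (L * (sqrt Mx + sqrt Mz))"
  shows "(1 - V) * (norm (grad (objective \<mu> \<nu> g) \<theta>))\<^sup>2
    \<le> grad (objective \<mu> \<nu> g) \<theta> \<bullet> approx_grad \<mu> \<nu> g ytilde \<theta>"
proof -
  interpret mu: prob_space \<mu> by fact
  interpret nu: prob_space \<nu> by fact
  let ?G = "grad_param g \<theta>" and ?p = "fixed_point g \<theta>" and ?w = "ytilde \<theta>"
  let ?D = "grad (objective \<mu> \<nu> g) \<theta>" and ?A = "approx_grad \<mu> \<nu> g ytilde \<theta>"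
  have exact: "approx_fixed_point \<nu> g \<epsilon>p \<theta> ?p"
    using \<nu>(2) \<open>0 < \<epsilon>p\<close> by (rule approx_fixed_point_exact)
  have mom: "second_moment_less \<mu> ?G Mx" "second_moment_less \<nu> (\<lambda>z. ?G (?p z)) Mz"
      "second_moment_less \<nu> (\<lambda>z. ?G (?w z)) Mz" and pos: "0 < Mx" "0 < Mz"
    using M exact residual by (auto simp: moment_constants_def)
  have meas: "?G \<in> borel_measurable \<mu>" "(\<lambda>z. ?G (?p z)) \<in> borel_measurable \<nu>"
      "(\<lambda>z. ?G (?w z)) \<in> borel_measurable \<nu>"
    using grad_param_measurable[of \<theta>] exact residual
    by (auto simp: measurable_cong_sets[OF \<mu>(2) refl] approx_fixed_point_def intro: measurable_compose)
  note int = second_moment_less_integrable[OF \<mu>(1) meas(1) mom(1)]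
    second_moment_less_integrable[OF \<nu>(1) meas(2) mom(2)]
    second_moment_less_integrable[OF \<nu>(1) meas(3) mom(3)]
  have D: "?D = (\<integral>x. ?G x \<partial>\<mu>) - (\<integral>z. ?G (?p z) \<partial>\<nu>)"
    by (rule grad_objective[OF \<mu> \<nu> int(1,2)])
  have "norm ?D \<le> norm (\<integral>x. ?G x \<partial>\<mu>) + norm (\<integral>z. ?G (?p z) \<partial>\<nu>)"
    unfolding D by (rule norm_triangle_ineq4)
  also have "\<dots> \<le> sqrt Mx + sqrt Mz"
    using meas mom
    by (intro add_mono mu.norm_integral_le_sqrt nu.norm_integral_le_sqrt)
       (auto simp: second_moment_less_def)
  finally have D_le: "norm ?D \<le> sqrt Mx + sqrt Mz" .
  \<comment> \<open>The expectations over \<open>\<mu>\<close> cancel, leaving only the effect of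
    the inexact fixed point.\<close>
  have "?D - ?A = (\<integral>z. ?G (?w z) - ?G (?p z) \<partial>\<nu>)"
    using int by (simp add: D approx_grad_def)
  also have "norm \<dots> \<le> (\<integral>z. norm (?G (?w z) - ?G (?p z)) \<partial>\<nu>)"
    by (rule integral_norm_bound)
  also have "\<dots> \<le> (\<integral>z. L * \<epsilon> \<partial>\<nu>)"
  proof (rule integral_mono)
    fix z
    show "norm (?G (?w z) - ?G (?p z)) \<le> L * \<epsilon>"
      using grad_param_dist[of \<theta> "?w z" "?p z"] close[of z] L_nonneg
      by (meson less_imp_le mult_left_mono order_trans)
  qed (use int in auto)
  finally have diff: "norm (?D - ?A) \<le> L * \<epsilon>" by (simp add: nu.prob_space)
  have S: "0 < sqrt Mx + sqrt Mz" using pos by (simp add: add_pos_pos)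
  \<comment> \<open>For \<open>L = 0\<close> the bound on \<open>\<epsilon>\<close> is the junk value \<open>x / 0 = 0\<close>, which contradicts \<open>0 < \<epsilon>\<close>.\<close>
  have "0 < \<epsilon>" using close norm_ge_zero by (rule le_less_trans[rotated])
  then have "L \<noteq> 0" using \<epsilon> by auto
  with L_nonneg have "0 < L" by simp
  with S have "0 < L * (sqrt Mx + sqrt Mz)" by simp
  with \<epsilon> have \<epsilon>': "L * \<epsilon> * (sqrt Mx + sqrt Mz) \<le> V * (norm ?D)\<^sup>2"
    by (simp add: pos_le_divide_eq mult_ac)
  have "?D \<bullet> (?D - ?A) \<le> norm ?D * norm (?D - ?A)"
    by (rule norm_cauchy_schwarz)
  also have "\<dots> \<le> (sqrt Mx + sqrt Mz) * (L * \<epsilon>)"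
    using D_le diff S by (intro mult_mono) auto
  also have "\<dots> \<le> V * (norm ?D)\<^sup>2" using \<epsilon>' by (simp add: mult_ac)
  finally show ?thesis
    unfolding inner_diff_right power2_norm_eq_inner left_diff_distrib by simp
qed

end

text \<open>The tolerance and the moment constants are functions of \<open>\<theta>\<close>, since
  the tolerance is compared with the gradient at \<open>\<theta>\<close>. The first conjunct ensures
  that suitable moment constants exist for the second.\<close>

theorem theorem3p7:
  fixes \<mu> \<nu> :: "(real^'d) measure"
    and g :: "real^'p \<Rightarrow> real^'d \<Rightarrow> real"
    and ytilde :: "real^'p \<Rightarrow> real^'d \<Rightarrow> real^'d"
    and L_inf L\<theta> Ly \<epsilon>p :: real
  assumes "prob_space \<mu>" and "sets \<mu> = sets borel"
    and "prob_space \<nu>" and "sets \<nu> = sets borel"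
    and convex: "\<And>\<theta>. convex_on UNIV (g \<theta>)"
    and bounded_below: "\<exists>S. open S \<and> S \<noteq> {} \<and> (\<forall>\<theta>\<in>S. L_inf \<le> objective \<mu> \<nu> g \<theta>)"
    and C1: "continuously_differentiable (\<lambda>(\<theta>, y). g \<theta> y)"
    and lipschitz_param: "\<And>y. L\<theta>-lipschitz_on UNIV (\<lambda>\<theta>. grad_param g \<theta> y)"
      "\<And>\<theta>. L\<theta>-lipschitz_on UNIV (\<lambda>y. grad_param g \<theta> y)"
    and lipschitz_space: "\<And>\<theta>. Ly-lipschitz_on UNIV (\<lambda>y. grad_space g \<theta> y)"
    and second_partials: "second_partials_param_exist g"
    and "0 < \<epsilon>p"
    and residual: "\<And>\<theta>. approx_fixed_point \<nu> g \<epsilon>p \<theta> (ytilde \<theta>)"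
    and "integrable \<mu> (\<lambda>x. (norm x)\<^sup>2)" and "integrable \<nu> (\<lambda>z. (norm z)\<^sup>2)"
  shows "(\<forall>\<theta>. \<exists>Mx Mz. moment_constants \<mu> \<nu> g \<epsilon>p \<theta> Mx Mz) \<and>
    (\<forall>(Mx :: real^'p \<Rightarrow> real) (Mz :: real^'p \<Rightarrow> real) (\<epsilon> :: real^'p \<Rightarrow> real) (V::real).
       (\<forall>\<theta>. moment_constants \<mu> \<nu> g \<epsilon>p \<theta> (Mx \<theta>) (Mz \<theta>)) \<longrightarrow>
       0 < V \<longrightarrow> V < 1 \<longrightarrow>
       (\<forall>\<theta> z. norm (ytilde \<theta> z - fixed_point g \<theta> z) < \<epsilon> \<theta>) \<longrightarrow>
       (\<forall>\<theta>. \<epsilon> \<theta> \<le> V * (norm (grad (objective \<mu> \<nu> g) \<theta>))\<^sup>2 /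
                     (L\<theta> * (sqrt (Mx \<theta>) + sqrt (Mz \<theta>)))) \<longrightarrow>
       (\<exists>U. U = 1 - V \<and> 0 < U \<and>
          (\<forall>\<theta>. grad (objective \<mu> \<nu> g) \<theta> \<bullet> approx_grad \<mu> \<nu> g ytilde \<theta>
               \<ge> U * (norm (grad (objective \<mu> \<nu> g) \<theta>))\<^sup>2)))"
proof -
  interpret smooth_convex_potential g L\<theta> Ly
    by unfold_locales (rule convex C1 lipschitz_param lipschitz_space)+
  note \<mu> = \<open>prob_space \<mu>\<close> \<open>sets \<mu> = sets borel\<close> \<open>integrable \<mu> (\<lambda>x. (norm x)\<^sup>2)\<close>
  note \<nu> = \<open>prob_space \<nu>\<close> \<open>sets \<nu> = sets borel\<close> \<open>integrable \<nu> (\<lambda>z. (norm z)\<^sup>2)\<close>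
  show ?thesis
  proof (rule conjI; intro allI impI)
    fix \<theta>
    show "\<exists>Mx Mz. moment_constants \<mu> \<nu> g \<epsilon>p \<theta> Mx Mz"
      by (rule moment_constants_exist[OF \<mu> \<nu>])
  next
    fix Mx Mz \<epsilon> :: "real^'p \<Rightarrow> real" and V :: real
    assume M: "\<forall>\<theta>. moment_constants \<mu> \<nu> g \<epsilon>p \<theta> (Mx \<theta>) (Mz \<theta>)"
      and "0 < V" "V < 1"
      and close: "\<forall>\<theta> z. norm (ytilde \<theta> z - fixed_point g \<theta> z) < \<epsilon> \<theta>"
      and \<epsilon>: "\<forall>\<theta>. \<epsilon> \<theta> \<le> V * (norm (grad (objective \<mu> \<nu> g) \<theta>))\<^sup>2 /
                     (L\<theta> * (sqrt (Mx \<theta>) + sqrt (Mz \<theta>)))"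
    have "(1 - V) * (norm (grad (objective \<mu> \<nu> g) \<theta>))\<^sup>2
        \<le> grad (objective \<mu> \<nu> g) \<theta> \<bullet> approx_grad \<mu> \<nu> g ytilde \<theta>" for \<theta>
      using M close \<epsilon> by (intro approx_grad_descent[OF \<mu> \<nu> \<open>0 < \<epsilon>p\<close> residual]) auto
    with \<open>V < 1\<close> show "\<exists>U. U = 1 - V \<and> 0 < U \<and>
        (\<forall>\<theta>. grad (objective \<mu> \<nu> g) \<theta> \<bullet> approx_grad \<mu> \<nu> g ytilde \<theta>
             \<ge> U * (norm (grad (objective \<mu> \<nu> g) \<theta>))\<^sup>2)"
      by simp
  qed
qed

end
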